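(* Let $0<\alpha<1$, $b>0$, let $f:[0,b]\to\mathbb R$ be absolutely continuous, and let $q_{N_b}^{\eta}\in L^2(0,b)$ be its piecewise local Legendre frame derivative approximation. Then $$\left\|{}^C D_{0+}^{\alpha}f-\mathcal D_{N_b,\eta}^{\alpha}f\right\|_{L^2(0,b)}\le\frac{b^{1-\alpha}}{\Gamma(2-\alpha)}\left\|f'-q_{N_b}^{\eta}\right\|_{L^2(0,b)} .$$ If $f'-q_{N_b}^{\eta}\in L^\infty(0,b)$, then $$\left\|{}^C D_{0+}^{\alpha}f-\mathcal D_{N_b,\eta}^{\alpha}f\right\|_{L^\infty(0,b)}\le\frac{b^{1-\alpha}}{\Gamma(2-\alpha)}\left\|f'-q_{N_b}^{\eta}\right\|_{L^\infty(0,b)} .$$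
   Context: Caputo derivative and its approximation: for $x\in(0,b]$, $${}^{C}D_{0+}^{\alpha}f(x)=\frac1{\Gamma(1-\alpha)}\int_0^x(x-\xi)^{-\alpha}f'(\xi)\,d\xi,\qquad \mathcal D_{N_b,\eta}^{\alpha}f(x)=\frac1{\Gamma(1-\alpha)}\int_0^{x}(x-\xi)^{-\alpha}q_{N_b}^{\eta}(\xi)\,d\xi .$$ (The first $L^2$ inequality is trivial if its right-hand side is infinite.) The function $q_{N_b}^\eta$ is defined as follows. Fix $T>1$, integers $N_b\ge 1$, $m\ge2$, a threshold $\eta>0$, and a diagonal weight matrix $R=\operatorname{diag}(r_0,\dots,r_{N_b-1})$ with positive entries (e.g. $r_j=e^{\beta j}$, $\beta\ge0$). Let $\{p_j\}$ be the orthonormal Legendre polynomials on $[-1,1]$, $P_j^{(T)}(t)=T^{-1/2}p_j(t/T)$, $t_l=-1+\frac{2l}{m-1}$ ($l=0,\dots,m-1$), and $A\in\mathbb R^{m\times N_b}$, $A_{lj}=m^{-1/2}P_j^{(T)}(t_l)$. Let $AR^{-1}=U\Sigma V^T$ be a singular value decomposition with singular values $\sigma_i$ and singular vectors $u_i,v_i$. For a function $g$ on $[-1,1]$ with $\mathbf g=(g(t_0),\dots,g(t_{m-1}))^T$ set $\mathbf c=R^{-1}\sum_{\sigma_i>\eta}\sigma_i^{-1}\langle m^{-1/2}\mathbf g,u_i\rangle v_i$ and $Q_{N_b,\eta}^{(T,R)}g=\sum_{j=0}^{N_b-1}c_jP_j^{(T)}|_{[-1,1]}$. Given a partition $0=a_0<a_1<\dots<a_K=b$,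 put $I_k=[a_{k-1},a_k]$, $c_k=\frac{a_{k-1}+a_k}2$, $s_k=\frac{a_k-a_{k-1}}2$, $g_k(t)=f(c_k+s_kt)$ for $t\in[-1,1]$, $q_{k,N_b,\eta}=Q_{N_b,\eta}^{(T,R)}g_k$, and $$q_{N_b}^\eta(x)=\frac{d}{dx}\,q_{k,N_b,\eta}\!\left(\frac{x-c_k}{s_k}\right),\qquad x\in I_k$$ (values at the finitely many partition points are immaterial). *)

theory Defs
  imports
    "HOL-Analysis.Analysis"
    "HOL-Probability.Essential_Supremum"
    "HOL-Computational_Algebra.Polynomial"
    "Jordan_Normal_Form.Matrix"
begin

unbundle no vec_syntax and no inner_syntax
hide_const (open) Finite_Cartesian_Product.vec Finite_Cartesian_Product.mat
  Finite_Cartesian_Product.row Finite_Cartesian_Product.column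
hide_type (open) Finite_Cartesian_Product.vec

section \<open>Absolutely continuous functions\<close>

definition abs_continuous_on :: "real \<Rightarrow> real \<Rightarrow> (real \<Rightarrow> real) \<Rightarrow> bool" where
  "abs_continuous_on a b f \<longleftrightarrow>
     (\<forall>\<epsilon>>0. \<exists>\<delta>>0. \<forall>S :: (real \<times> real) set.
        finite S \<longrightarrow>
        (\<forall>(u, v)\<in>S. a \<le> u \<and> u < v \<and> v \<le> b) \<longrightarrow>
        pairwise (\<lambda>p p'. disjnt {fst p<..<snd p} {fst p'<..<snd p'}) S \<longrightarrow>
        (\<Sum>(u, v)\<in>S. v - u) < \<delta> \<longrightarrow>
        (\<Sum>(u, v)\<in>S. \<bar>f v - f u\<bar>) < \<epsilon>)"

section \<open>Extended norms\<close>

text \<open>The value is \<^term>\<open>\<infinity> :: ennreal\<close> exactly when the function does not belong to the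
  space; in particular it is \<^term>\<open>\<infinity> :: ennreal\<close> for a non-measurable function.\<close>

definition L2_norm :: "'a measure \<Rightarrow> ('a \<Rightarrow> real) \<Rightarrow> ennreal" where
  "L2_norm M g =
     (if g \<in> borel_measurable M \<and> integrable M (\<lambda>x. (g x)\<^sup>2)
      then ennreal (sqrt (\<integral>x. (g x)\<^sup>2 \<partial>M)) else \<infinity>)"

definition Linf_norm :: "'a measure \<Rightarrow> ('a \<Rightarrow> real) \<Rightarrow> ennreal" where
  "Linf_norm M g =
     (if g \<in> borel_measurable M then esssup M (\<lambda>x. ennreal \<bar>g x\<bar>) else \<infinity>)"

section \<open>Fractional integrals and the Caputo derivative\<close>

definition frac_kernel_integral :: "real \<Rightarrow> (real \<Rightarrow> real) \<Rightarrow> real \<Rightarrow> real" where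
  "frac_kernel_integral \<alpha> h x =
     1 / Gamma (1 - \<alpha>) * (LINT \<xi>:{0..x}|lebesgue. (x - \<xi>) powr (- \<alpha>) * h \<xi>)"

text \<open>For absolutely continuous \<open>f\<close> the derivative exists almost everywhere; the arbitrary
  values of \<^const>\<open>deriv\<close> at the remaining points do not affect the integral.\<close>

definition caputo_deriv :: "real \<Rightarrow> (real \<Rightarrow> real) \<Rightarrow> real \<Rightarrow> real" where
  "caputo_deriv \<alpha> f = frac_kernel_integral \<alpha> (deriv f)"

section \<open>The Legendre frame\<close>

text \<open>Rodrigues' formula, normalised so that
  \<open>\<integral> p\<^sub>i p\<^sub>j = \<delta>\<^sub>i\<^sub>j\<close> over \<open>[-1, 1]\<close>.\<close>

definition legendre_poly :: "nat \<Rightarrow> real poly" where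
  "legendre_poly j =
     Polynomial.smult (sqrt ((2 * real j + 1) / 2) / (2 ^ j * fact j)) ((pderiv ^^ j) ([:- 1, 0, 1:] ^ j))"

definition frame_fun :: "real \<Rightarrow> nat \<Rightarrow> real \<Rightarrow> real" where
  "frame_fun T j t = 1 / sqrt T * poly (legendre_poly j) (t / T)"

definition node :: "nat \<Rightarrow> nat \<Rightarrow> real" where
  "node m l = - 1 + 2 * real l / (real m - 1)"

definition frame_mat :: "real \<Rightarrow> nat \<Rightarrow> nat \<Rightarrow> real mat" where
  "frame_mat T m N = mat m N (\<lambda>(l, j). frame_fun T j (node m l) / sqrt (real m))"

definition inv_weight_mat :: "nat \<Rightarrow> (nat \<Rightarrow> real) \<Rightarrow> real mat" where
  "inv_weight_mat N r = mat_diag N (\<lambda>j. inverse (r j))"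

lemma inv_weight_mat_inverts:
  assumes "\<And>j. j < N \<Longrightarrow> r j > 0"
  shows "mat_diag N r * inv_weight_mat N r = 1\<^sub>m N"
    and "inv_weight_mat N r * mat_diag N r = 1\<^sub>m N"
proof -
  have "r j * inverse (r j) = 1" "inverse (r j) * r j = 1" if "j < N" for j
    using assms[OF that] by simp_all
  then show "mat_diag N r * inv_weight_mat N r = 1\<^sub>m N"
    and "inv_weight_mat N r * mat_diag N r = 1\<^sub>m N"
    unfolding inv_weight_mat_def mat_diag_diag by (auto intro!: eq_matI simp: mat_diag_def)
qed

text \<open>Full singular value decomposition; the singular values, the diagonal entries of \<open>S\<close>, may
  appear in any order.\<close>

definition is_svd :: "real mat \<Rightarrow> real mat \<Rightarrow> real mat \<Rightarrow> real mat \<Rightarrow> bool" where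
  "is_svd M U S V \<longleftrightarrow>
     (let m = dim_row M; n = dim_col M in
        U \<in> carrier_mat m m \<and> S \<in> carrier_mat m n \<and> V \<in> carrier_mat n n \<and>
        transpose_mat U * U = 1\<^sub>m m \<and> transpose_mat V * V = 1\<^sub>m n \<and>
        (\<forall>i<m. \<forall>j<n. i \<noteq> j \<longrightarrow> S $$ (i, j) = 0) \<and>
        (\<forall>i<min m n. S $$ (i, i) \<ge> 0) \<and>
        M = U * S * transpose_mat V)"

section \<open>Truncated frame approximation and its piecewise derivative\<close>

definition frame_coeffs ::
  "nat \<Rightarrow> nat \<Rightarrow> (nat \<Rightarrow> real) \<Rightarrow> real \<Rightarrow> real mat \<Rightarrow> real mat \<Rightarrow> real mat \<Rightarrow>
     (real \<Rightarrow> real) \<Rightarrow> real vec" where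
  "frame_coeffs m N r \<eta> U S V g =
     inv_weight_mat N r *\<^sub>v
       vec N (\<lambda>j. \<Sum>i | i < min m N \<and> S $$ (i, i) > \<eta>.
         inverse (S $$ (i, i)) *
         (vec m (\<lambda>l. g (node m l) / sqrt (real m)) \<bullet> col U i) * (col V i $ j))"

definition frame_approx ::
  "real \<Rightarrow> nat \<Rightarrow> nat \<Rightarrow> (nat \<Rightarrow> real) \<Rightarrow> real \<Rightarrow> real mat \<Rightarrow> real mat \<Rightarrow> real mat \<Rightarrow>
     (real \<Rightarrow> real) \<Rightarrow> real \<Rightarrow> real" where
  "frame_approx T m N r \<eta> U S V g t =
     (\<Sum>j<N. frame_coeffs m N r \<eta> U S V g $ j * frame_fun T j t)"

text \<open>The subintervals are indexed from \<open>0\<close>: the index \<open>k < K\<close> stands for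
  \<open>[a k, a (Suc k)]\<close>. The value at the partition points, which is immaterial, is set to \<open>0\<close>.\<close>

definition piecewise_frame_deriv ::
  "real \<Rightarrow> nat \<Rightarrow> nat \<Rightarrow> (nat \<Rightarrow> real) \<Rightarrow> real \<Rightarrow> real mat \<Rightarrow> real mat \<Rightarrow> real mat \<Rightarrow>
     nat \<Rightarrow> (nat \<Rightarrow> real) \<Rightarrow> (real \<Rightarrow> real) \<Rightarrow> real \<Rightarrow> real" where
  "piecewise_frame_deriv T m N r \<eta> U S V K a f x =
     (\<Sum>k<K. indicator {a k<..<a (Suc k)} x *
        (let c = (a k + a (Suc k)) / 2; s = (a (Suc k) - a k) / 2;
             g = (\<lambda>t. f (c + s * t))
         in deriv (\<lambda>y. frame_approx T m N r \<eta> U S V g ((y - c) / s)) x))"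

end

theory Submission
  imports Defs
begin

text \<open>By linearity the error is the Riemann--Liouville integral of order \<open>1 - \<alpha>\<close> of
  \<open>h = f' - q\<close>. Its kernel \<open>(x - \<xi>) powr (- \<alpha>)\<close> on \<open>0 < \<xi> < x < b\<close> integrates to at most
  \<open>C = b powr (1 - \<alpha>) / (1 - \<alpha>)\<close> in either variable, so the Schur test bounds the operator
  by \<open>C\<close> on \<open>L\<^sup>2\<close>, and trivially on \<open>L\<^sup>\<infinity>\<close>; moreover
  \<open>C / Gamma (1 - \<alpha>) = b powr (1 - \<alpha>) / Gamma (2 - \<alpha>)\<close>. Since Fubini is applied over the
  Borel sets, the Lebesgue measurable data are first replaced by Borel representatives,
  which changes none of the integrals.\<close>

section \<open>The Schur test\<close>

text \<open>Cauchy-Schwarz against the measure with density \<open>k x\<close> costs one row bound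
  \<open>A\<close> and leaves \<open>k\<close> to the first power, so after Tonelli the inner
  integral is a column integral, bounded by \<open>B\<close>. In \<open>ennreal\<close> the order of
  integration may be exchanged without integrability conditions.\<close>

lemma schur_test_nn_integral:
  fixes k :: "'a \<Rightarrow> 'b \<Rightarrow> ennreal"
  assumes "sigma_finite_measure M" and "sigma_finite_measure N"
    and k[measurable]: "(\<lambda>(x, y). k x y) \<in> borel_measurable (M \<Otimes>\<^sub>M N)"
    and g[measurable]: "g \<in> borel_measurable N"
    and A: "\<And>x. x \<in> space M \<Longrightarrow> (\<integral>\<^sup>+y. k x y \<partial>N) \<le> A"
    and B: "\<And>y. y \<in> space N \<Longrightarrow> (\<integral>\<^sup>+x. k x y \<partial>M) \<le> B"
  shows "(\<integral>\<^sup>+x. (\<integral>\<^sup>+y. k x y * g y \<partial>N)\<^sup>2 \<partial>M) \<le> A * B * (\<integral>\<^sup>+y. (g y)\<^sup>2 \<partial>N)"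
proof -
  interpret M: sigma_finite_measure M by fact
  interpret N: sigma_finite_measure N by fact
  interpret pair_sigma_finite M N ..
  \<comment> \<open>Cauchy--Schwarz for the measure with density \<open>k x\<close>, applied to \<open>g\<close> and \<open>1\<close>\<close>
  have cs: "(\<integral>\<^sup>+y. k x y * g y \<partial>N)\<^sup>2 \<le> A * (\<integral>\<^sup>+y. k x y * (g y)\<^sup>2 \<partial>N)"
    if x: "x \<in> space M" for x
  proof -
    have [measurable]: "k x \<in> borel_measurable N"
      using measurable_Pair2[OF k x] by simp
    have "(\<integral>\<^sup>+y. k x y * g y \<partial>N)\<^sup>2 = (\<integral>\<^sup>+y. 1 * g y \<partial>density N (k x))\<^sup>2"
      by (simp add: nn_integral_density)
    also have "\<dots> \<le> (\<integral>\<^sup>+y. 1\<^sup>2 \<partial>density N (k x)) * (\<integral>\<^sup>+y. (g y)\<^sup>2 \<partial>density N (k x))"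
      by (rule Cauchy_Schwarz_nn_integral) auto
    also have "\<dots> = (\<integral>\<^sup>+y. k x y \<partial>N) * (\<integral>\<^sup>+y. k x y * (g y)\<^sup>2 \<partial>N)"
      by (subst (1 2) nn_integral_density) auto
    also have "\<dots> \<le> A * (\<integral>\<^sup>+y. k x y * (g y)\<^sup>2 \<partial>N)"
      by (intro mult_right_mono A x) auto
    finally show ?thesis .
  qed
  have "(\<integral>\<^sup>+x. (\<integral>\<^sup>+y. k x y * g y \<partial>N)\<^sup>2 \<partial>M) \<le> (\<integral>\<^sup>+x. A * (\<integral>\<^sup>+y. k x y * (g y)\<^sup>2 \<partial>N) \<partial>M)"
    by (intro nn_integral_mono cs)
  also have "\<dots> = A * (\<integral>\<^sup>+x. (\<integral>\<^sup>+y. k x y * (g y)\<^sup>2 \<partial>N) \<partial>M)"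
    by (intro nn_integral_cmult) measurable
  also have "(\<integral>\<^sup>+x. (\<integral>\<^sup>+y. k x y * (g y)\<^sup>2 \<partial>N) \<partial>M) = (\<integral>\<^sup>+y. (\<integral>\<^sup>+x. k x y * (g y)\<^sup>2 \<partial>M) \<partial>N)"
    by (rule Fubini'[symmetric]) measurable
  also have "\<dots> = (\<integral>\<^sup>+y. (\<integral>\<^sup>+x. k x y \<partial>M) * (g y)\<^sup>2 \<partial>N)"
    by (intro nn_integral_cong nn_integral_multc) measurable
  also have "\<dots> \<le> (\<integral>\<^sup>+y. B * (g y)\<^sup>2 \<partial>N)"
    by (intro nn_integral_mono mult_right_mono B) auto
  also have "\<dots> = B * (\<integral>\<^sup>+y. (g y)\<^sup>2 \<partial>N)"
    by (intro nn_integral_cmult) measurable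
  finally show ?thesis
    by (simp add: mult_left_mono mult.assoc)
qed

section \<open>The Abel kernel\<close>

text \<open>Both cut-offs sit inside the kernel, so that every integral below runs over all of
  \<open>lborel\<close>. On the diagonal the value is \<open>0 powr (- \<alpha>) = 0\<close>, so the
  singularity needs no separate case.\<close>

definition abel_kernel :: "real \<Rightarrow> real \<Rightarrow> real \<Rightarrow> real \<Rightarrow> real" where
  "abel_kernel \<alpha> b x y = indicator {0<..<b} x * (indicator {0..x} y * (x - y) powr (- \<alpha>))"

lemma abel_kernel_nonneg: "0 \<le> abel_kernel \<alpha> b x y"
  by (simp add: abel_kernel_def)

lemma measurable_abel_kernel [measurable]:
  "(\<lambda>(x, y). abel_kernel \<alpha> b x y) \<in> borel_measurable (borel \<Otimes>\<^sub>M borel)"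
proof -
  \<comment> \<open>The set \<open>{0..x}\<close> moves with \<open>x\<close>; joint measurability
    becomes visible once the indicators are comparisons between the coordinates.\<close>
  have "(\<lambda>(x, y). abel_kernel \<alpha> b x y) =
      (\<lambda>(x, y). if 0 < x \<and> x < b \<and> 0 \<le> y \<and> y \<le> x then (x - y) powr (- \<alpha>) else 0)"
    by (auto simp: abel_kernel_def indicator_def)
  also have "\<dots> \<in> borel_measurable (borel \<Otimes>\<^sub>M borel)"
    by measurable
  finally show ?thesis .
qed

lemma nn_integral_powr_from_0:
  fixes \<alpha> c :: real
  assumes "\<alpha> < 1" and "c \<ge> 0"
  shows "(\<integral>\<^sup>+u. ennreal (indicator {0..c} u * u powr (- \<alpha>)) \<partial>lborel)
           = ennreal (c powr (1 - \<alpha>) / (1 - \<alpha>))"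
  using nn_integral_has_integral_lebesgue[OF _ has_integral_powr_from_0[of "- \<alpha>" c]] assms
  by simp

lemma nn_integral_abel_kernel_right:
  assumes "\<alpha> < 1"
  shows "(\<integral>\<^sup>+y. ennreal (abel_kernel \<alpha> b x y) \<partial>lborel) \<le> ennreal (b powr (1 - \<alpha>) / (1 - \<alpha>))"
proof (cases "x \<in> {0<..<b}")
  case True
  \<comment> \<open>The substitution \<open>y = x - u\<close> moves the singularity to
    \<open>0\<close>, leaving an explicit integral over \<open>{0..x}\<close> that increases with
    \<open>x\<close>.\<close>
  have "(\<integral>\<^sup>+y. ennreal (abel_kernel \<alpha> b x y) \<partial>lborel)
      = (\<integral>\<^sup>+u. ennreal (abel_kernel \<alpha> b x (x + (- 1) * u)) \<partial>lborel)"
    by (subst nn_integral_real_affine[where c = "- 1" and t = x]) auto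
  also have "\<dots> = (\<integral>\<^sup>+u. ennreal (indicator {0..x} u * u powr (- \<alpha>)) \<partial>lborel)"
    using True by (intro nn_integral_cong) (auto simp: abel_kernel_def indicator_def)
  also have "\<dots> = ennreal (x powr (1 - \<alpha>) / (1 - \<alpha>))"
    using True assms by (intro nn_integral_powr_from_0) auto
  also have "\<dots> \<le> ennreal (b powr (1 - \<alpha>) / (1 - \<alpha>))"
    using True assms by (intro ennreal_leI divide_right_mono powr_mono2) auto
  finally show ?thesis .
qed (simp add: abel_kernel_def)

lemma nn_integral_abel_kernel_left:
  assumes "\<alpha> < 1"
  shows "(\<integral>\<^sup>+x. ennreal (abel_kernel \<alpha> b x y) \<partial>lborel) \<le> ennreal (b powr (1 - \<alpha>) / (1 - \<alpha>))"
proof (cases "y \<in> {0..<b}")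
  case True
  have "(\<integral>\<^sup>+x. ennreal (abel_kernel \<alpha> b x y) \<partial>lborel)
      = (\<integral>\<^sup>+u. ennreal (abel_kernel \<alpha> b (y + 1 * u) y) \<partial>lborel)"
    by (subst nn_integral_real_affine[where c = 1 and t = y]) auto
  \<comment> \<open>With \<open>x = y + u\<close> the support is \<open>0 \<le> u < b - y\<close>,
    and \<open>y \<ge> 0\<close> puts it inside \<open>{0..b}\<close>.\<close>
  also have "\<dots> \<le> (\<integral>\<^sup>+u. ennreal (indicator {0..b} u * u powr (- \<alpha>)) \<partial>lborel)"
    using True by (intro nn_integral_mono) (auto simp: abel_kernel_def indicator_def)
  also have "\<dots> = ennreal (b powr (1 - \<alpha>) / (1 - \<alpha>))"
    using True assms by (intro nn_integral_powr_from_0) auto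
  finally show ?thesis .
next
  case False
  then have "abel_kernel \<alpha> b x y = 0" for x
    by (auto simp: abel_kernel_def indicator_def)
  then show ?thesis by simp
qed

text \<open>Rows and columns have the same bound, so the product \<open>A * B\<close> of the Schur
  test is a square.\<close>

lemma abel_kernel_L2_bound:
  fixes g :: "real \<Rightarrow> real"
  assumes "\<alpha> < 1" and [measurable]: "g \<in> borel_measurable borel"
  shows "(\<integral>\<^sup>+x. (\<integral>\<^sup>+y. ennreal (abel_kernel \<alpha> b x y * \<bar>g y\<bar>) \<partial>lborel)\<^sup>2 \<partial>lborel)
           \<le> ennreal ((b powr (1 - \<alpha>) / (1 - \<alpha>))\<^sup>2) * (\<integral>\<^sup>+y. ennreal ((g y)\<^sup>2) \<partial>lborel)"
proof -
  let ?C = "b powr (1 - \<alpha>) / (1 - \<alpha>)"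
  have "(\<integral>\<^sup>+x. (\<integral>\<^sup>+y. ennreal (abel_kernel \<alpha> b x y) * ennreal \<bar>g y\<bar> \<partial>lborel)\<^sup>2 \<partial>lborel)
      \<le> ennreal ?C * ennreal ?C * (\<integral>\<^sup>+y. (ennreal \<bar>g y\<bar>)\<^sup>2 \<partial>lborel)"
    using nn_integral_abel_kernel_right[OF assms(1)] nn_integral_abel_kernel_left[OF assms(1)]
    by (intro schur_test_nn_integral sigma_finite_lborel) auto
  then show ?thesis
    using assms(1)
    by (simp add: ennreal_mult[symmetric] ennreal_power abel_kernel_nonneg power2_eq_square)
qed

text \<open>The previous bound makes the integral of a nonnegative square finite; hence the square,
  and with it the inner integral of absolute values, is finite almost everywhere.\<close>

lemma AE_integrable_abel_kernel:
  fixes g :: "real \<Rightarrow> real"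
  assumes "\<alpha> < 1" and g[measurable]: "g \<in> borel_measurable borel"
    and fin: "(\<integral>\<^sup>+y. ennreal ((g y)\<^sup>2) \<partial>lborel) < \<infinity>"
  shows "AE x in lborel. integrable lborel (\<lambda>y. abel_kernel \<alpha> b x y * g y)"
proof -
  have "(\<integral>\<^sup>+x. (\<integral>\<^sup>+y. ennreal (abel_kernel \<alpha> b x y * \<bar>g y\<bar>) \<partial>lborel)\<^sup>2 \<partial>lborel) < \<infinity>"
    using fin by (intro le_less_trans[OF abel_kernel_L2_bound[OF assms(1) g]])
      (auto simp: ennreal_mult_less_top)
  then have "AE x in lborel. (\<integral>\<^sup>+y. ennreal (abel_kernel \<alpha> b x y * \<bar>g y\<bar>) \<partial>lborel)\<^sup>2 \<noteq> \<infinity>"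
    by (intro nn_integral_PInf_AE) auto
  then show ?thesis
    by eventually_elim
      (auto simp: integrable_iff_bounded abs_mult abel_kernel_nonneg power_eq_top_ennreal less_top)
qed

section \<open>Borel representatives\<close>

text \<open>Lebesgue measure is the completion of \<open>lborel\<close>, so the extension of
  \<open>g\<close> by 0 agrees almost everywhere with some Borel \<open>g0\<close>. Multiplying
  \<open>g0\<close> by the indicator makes it vanish at every point off \<open>A\<close>.\<close>

lemma lebesgue_on_Borel_representative:
  fixes g :: "real \<Rightarrow> real"
  assumes "g \<in> borel_measurable (lebesgue_on A)" and A[measurable]: "A \<in> sets borel"
  obtains g' where "g' \<in> borel_measurable borel" and "\<And>x. x \<notin> A \<Longrightarrow> g' x = 0"
    and "AE x in lebesgue. x \<in> A \<longrightarrow> g x = g' x"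
proof -
  have "(\<lambda>x. indicator A x *\<^sub>R g x) \<in> borel_measurable lebesgue"
    using assms by (subst borel_measurable_restrict_space_iff[symmetric]) auto
  from completion_ex_borel_measurable_real[OF this]
  obtain g0 where [measurable]: "g0 \<in> borel_measurable borel"
    and g0: "AE x in lborel. indicator A x *\<^sub>R g x = g0 x"
    by auto
  show ?thesis
  proof
    show "(\<lambda>x. indicator A x * g0 x) \<in> borel_measurable borel" by measurable
    show "AE x in lebesgue. x \<in> A \<longrightarrow> g x = indicator A x * g0 x"
      using AE_completion[OF g0] by eventually_elim auto
  qed auto
qed

text \<open>Since \<open>\<phi> 0 = 0\<close>, points off \<open>A\<close> contribute nothing, and
  an integral over \<open>A\<close> becomes one over the whole line. It is used with the square as
  \<open>\<phi>\<close>.\<close>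

lemma nn_integral_lebesgue_on_representative:
  fixes \<phi> :: "real \<Rightarrow> ennreal"
  assumes "AE x in lebesgue. x \<in> A \<longrightarrow> g x = g' x" and "\<And>x. x \<notin> A \<Longrightarrow> g' x = 0"
    and "\<phi> 0 = 0" and [measurable]: "A \<in> sets borel"
  shows "(\<integral>\<^sup>+x. \<phi> (g x) \<partial>lebesgue_on A) = (\<integral>\<^sup>+x. \<phi> (g' x) \<partial>lborel)"
proof -
  have "(\<integral>\<^sup>+x. \<phi> (g x) \<partial>lebesgue_on A) = (\<integral>\<^sup>+x. \<phi> (g x) * indicator A x \<partial>lebesgue)"
    by (intro nn_integral_restrict_space) auto
  also have "\<dots> = (\<integral>\<^sup>+x. \<phi> (g' x) \<partial>lebesgue)"
    using assms(1)
    by (intro nn_integral_cong_AE, eventually_elim) (auto simp: indicator_def assms(2,3))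
  finally show ?thesis by (simp add: nn_integral_completion)
qed

text \<open>The identity holds at every \<open>x\<close> of the interval, because for each fixed
  \<open>x\<close> the integrand changes only on a null set.\<close>

lemma frac_kernel_integral_representative:
  assumes ae: "AE y in lebesgue. y \<in> {0<..<b} \<longrightarrow> g y = g' y"
    and [measurable]: "g' \<in> borel_measurable borel" and x: "x \<in> {0<..<b}"
  shows "frac_kernel_integral \<alpha> g x
           = 1 / Gamma (1 - \<alpha>) * (\<integral>y. abel_kernel \<alpha> b x y * g' y \<partial>lborel)"
proof -
  let ?G = "\<lambda>y. indicator {0..x} y *\<^sub>R ((x - y) powr (- \<alpha>) * g y)"
  let ?G' = "\<lambda>y. abel_kernel \<alpha> b x y * g' y"
  have G': "?G' \<in> borel_measurable lborel" by measurable
  \<comment> \<open>The fractional integral runs over the closed \<open>{0..x}\<close>, whereas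
    \<open>ae\<close> says nothing at the endpoint 0.\<close>
  have "AE y in lebesgue. y \<noteq> (0 :: real)"
    by (rule AE_completion[OF AE_lborel_singleton])
  with ae have eq: "AE y in lebesgue. ?G' y = ?G y"
    by eventually_elim (use x in \<open>auto simp: abel_kernel_def indicator_def\<close>)
  \<comment> \<open>Completeness of Lebesgue measure transfers measurability along almost everywhere
    equality.\<close>
  have meas: "?G \<in> borel_measurable lebesgue"
    using measurable_completion[OF G'] eq by (rule borel_measurable_AE)
  have "(\<integral>y. ?G y \<partial>lebesgue) = (\<integral>y. ?G' y \<partial>lebesgue)"
    using eq by (intro integral_cong_AE meas measurable_completion[OF G']) auto
  then show ?thesis
    by (simp add: frac_kernel_integral_def set_lebesgue_integral_def integral_completion[OF G'])
qed

section \<open>The norms\<close>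

lemma L2_norm_finite_iff:
  "L2_norm M g < top_class.top \<longleftrightarrow> g \<in> borel_measurable M \<and> (\<integral>\<^sup>+x. ennreal ((g x)\<^sup>2) \<partial>M) < top_class.top"
  by (auto simp: L2_norm_def integrable_iff_bounded)

lemma L2_norm_le:
  assumes [measurable]: "F \<in> borel_measurable M" and fin: "L2_norm M h < \<infinity>" and "C \<ge> 0"
    and le: "(\<integral>\<^sup>+x. ennreal ((F x)\<^sup>2) \<partial>M) \<le> ennreal (C\<^sup>2) * (\<integral>\<^sup>+x. ennreal ((h x)\<^sup>2) \<partial>M)"
  shows "L2_norm M F \<le> ennreal C * L2_norm M h"
proof -
  have h[measurable]: "h \<in> borel_measurable M" and int_h: "integrable M (\<lambda>x. (h x)\<^sup>2)"
    using fin by (auto simp: L2_norm_finite_iff integrable_iff_bounded)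
  then have "(\<integral>\<^sup>+x. ennreal ((F x)\<^sup>2) \<partial>M) \<le> ennreal (C\<^sup>2 * (\<integral>x. (h x)\<^sup>2 \<partial>M))"
    using le by (simp add: nn_integral_eq_integral ennreal_mult)
  \<comment> \<open>Without square integrability of \<open>F\<close>, \<open>L2_norm\<close> would
    take its default value infinity.\<close>
  moreover from this have int_F: "integrable M (\<lambda>x. (F x)\<^sup>2)"
    by (auto simp: integrable_iff_bounded intro: le_less_trans)
  ultimately have "(\<integral>x. (F x)\<^sup>2 \<partial>M) \<le> C\<^sup>2 * (\<integral>x. (h x)\<^sup>2 \<partial>M)"
    by (simp add: nn_integral_eq_integral)
  then have "sqrt (\<integral>x. (F x)\<^sup>2 \<partial>M) \<le> sqrt (C\<^sup>2 * (\<integral>x. (h x)\<^sup>2 \<partial>M))"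
    by simp
  also have "\<dots> = C * sqrt (\<integral>x. (h x)\<^sup>2 \<partial>M)"
    using \<open>C \<ge> 0\<close> by (simp add: real_sqrt_mult)
  finally show ?thesis
    using int_F int_h \<open>C \<ge> 0\<close>
    by (simp add: L2_norm_def ennreal_mult[symmetric] ennreal_leI)
qed

text \<open>Writing \<open>g = (g - q) + q\<close> gives both measurability and, by
  \<open>(s + t)^2 \<le> 2 s^2 + 2 t^2\<close>, finiteness. This recovers square integrability of
  \<open>f'\<close> from that of the error and of \<open>q\<close>.\<close>

lemma L2_norm_finite_diff_imp:
  assumes "L2_norm M (\<lambda>x. g x - q x) < \<infinity>" and "L2_norm M q < \<infinity>"
  shows "L2_norm M g < \<infinity>"
proof -
  have [measurable]: "(\<lambda>x. g x - q x) \<in> borel_measurable M" "q \<in> borel_measurable M"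
    using assms by (auto simp: L2_norm_finite_iff)
  have g: "(\<lambda>x. (g x - q x) + q x) \<in> borel_measurable M" by measurable
  have sq: "(s + t)\<^sup>2 \<le> 2 * s\<^sup>2 + 2 * t\<^sup>2" for s t :: real
    using sum_squares_bound[of s t] by (simp add: power2_sum)
  have "(g x)\<^sup>2 \<le> 2 * (g x - q x)\<^sup>2 + 2 * (q x)\<^sup>2" for x
    using sq[of "g x - q x" "q x"] by simp
  moreover have sum: "2 * ennreal (s\<^sup>2) + 2 * ennreal (t\<^sup>2) = ennreal (2 * s\<^sup>2 + 2 * t\<^sup>2)" for s t :: real
    by (simp add: ennreal_plus ennreal_mult)
  ultimately have "(\<integral>\<^sup>+x. ennreal ((g x)\<^sup>2) \<partial>M)
      \<le> (\<integral>\<^sup>+x. 2 * ennreal ((g x - q x)\<^sup>2) + 2 * ennreal ((q x)\<^sup>2) \<partial>M)"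
    using sum by (intro nn_integral_mono) (simp only: ennreal_leI)
  also have "\<dots> = 2 * (\<integral>\<^sup>+x. ennreal ((g x - q x)\<^sup>2) \<partial>M) + 2 * (\<integral>\<^sup>+x. ennreal ((q x)\<^sup>2) \<partial>M)"
    by (subst nn_integral_add) (auto simp: nn_integral_cmult)
  also have "\<dots> < \<infinity>"
    using assms by (auto simp: L2_norm_finite_iff ennreal_mult_less_top)
  finally show ?thesis
    using g by (simp add: L2_norm_finite_iff)
qed

lemma AE_abs_le_Linf_norm:
  assumes "Linf_norm M h < \<infinity>"
  shows "h \<in> borel_measurable M" and "AE x in M. \<bar>h x\<bar> \<le> enn2real (Linf_norm M h)"
proof -
  show h: "h \<in> borel_measurable M"
    using assms by (auto simp: Linf_norm_def split: if_splits)
  have "AE x in M. ennreal \<bar>h x\<bar> \<le> Linf_norm M h"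
    using esssup_AE[where f = "\<lambda>x. ennreal \<bar>h x\<bar>" and M = M] h by (simp add: Linf_norm_def)
  then show "AE x in M. \<bar>h x\<bar> \<le> enn2real (Linf_norm M h)"
    by eventually_elim (use assms in \<open>metis enn2real_leI enn2real_mono abs_ge_zero
      enn2real_ennreal infinity_ennreal_def\<close>)
qed

text \<open>It lets the supremum estimate use the same splitting of integrals as the square
  integrable case.\<close>

lemma L2_norm_finite_if_Linf_norm_finite:
  assumes "finite_measure M" and "Linf_norm M h < \<infinity>"
  shows "L2_norm M h < \<infinity>"
proof -
  interpret finite_measure M by fact
  let ?E = "enn2real (Linf_norm M h)"
  have "(\<integral>\<^sup>+x. ennreal ((h x)\<^sup>2) \<partial>M) \<le> (\<integral>\<^sup>+x. ennreal (?E\<^sup>2) \<partial>M)"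
    using AE_abs_le_Linf_norm(2)[OF assms(2)]
    by (intro nn_integral_mono_AE, eventually_elim)
      (auto intro!: ennreal_leI simp: abs_le_square_iff[symmetric])
  also have "\<dots> < \<infinity>"
    by (simp add: ennreal_mult_eq_top_iff less_top[symmetric])
  finally show ?thesis
    using AE_abs_le_Linf_norm(1)[OF assms(2)] by (simp add: L2_norm_finite_iff)
qed

section \<open>Boundedness of the fractional integral\<close>

text \<open>Finiteness of both \<open>L\<^sup>2\<close> norms makes the two singular integrals converge at almost every
  point, which is what allows the difference of the integrals to be taken under the integral sign.\<close>

lemma frac_kernel_integral_diff_representative:
  fixes b \<alpha> :: real and g q :: "real \<Rightarrow> real"
  defines "M \<equiv> lebesgue_on {0<..<b}"
  assumes "\<alpha> < 1" and g: "L2_norm M g < \<infinity>" and q: "L2_norm M q < \<infinity>"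
  obtains h where "h \<in> borel_measurable borel" and "\<And>x. x \<notin> {0<..<b} \<Longrightarrow> h x = 0"
    and "AE x in lebesgue. x \<in> {0<..<b} \<longrightarrow> g x - q x = h x"
    and "(\<lambda>x. frac_kernel_integral \<alpha> g x - frac_kernel_integral \<alpha> q x) \<in> borel_measurable M"
    and "AE x in M. \<bar>frac_kernel_integral \<alpha> g x - frac_kernel_integral \<alpha> q x\<bar>
           \<le> 1 / Gamma (1 - \<alpha>) * (\<integral>\<^sup>+y. ennreal (abel_kernel \<alpha> b x y * \<bar>h y\<bar>) \<partial>lborel)"
proof -
  let ?J = "\<lambda>u x. \<integral>y. abel_kernel \<alpha> b x y * u y \<partial>lborel"
  let ?D = "\<lambda>x. frac_kernel_integral \<alpha> g x - frac_kernel_integral \<alpha> q x"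
  have Gamma_pos: "Gamma (1 - \<alpha>) > 0"
    using \<open>\<alpha> < 1\<close> by (intro Gamma_real_pos) auto
  obtain g' where g'[measurable]: "g' \<in> borel_measurable borel" "\<And>x. x \<notin> {0<..<b} \<Longrightarrow> g' x = 0"
    and g'_eq: "AE x in lebesgue. x \<in> {0<..<b} \<longrightarrow> g x = g' x"
    by (rule lebesgue_on_Borel_representative[of g "{0<..<b}"])
      (use g in \<open>simp_all add: L2_norm_finite_iff M_def\<close>)
  obtain q' where q'[measurable]: "q' \<in> borel_measurable borel" "\<And>x. x \<notin> {0<..<b} \<Longrightarrow> q' x = 0"
    and q'_eq: "AE x in lebesgue. x \<in> {0<..<b} \<longrightarrow> q x = q' x"
    by (rule lebesgue_on_Borel_representative[of q "{0<..<b}"])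
      (use q in \<open>simp_all add: L2_norm_finite_iff M_def\<close>)
  have "(\<integral>\<^sup>+x. ennreal ((g' x)\<^sup>2) \<partial>lborel) < \<infinity>" "(\<integral>\<^sup>+x. ennreal ((q' x)\<^sup>2) \<partial>lborel) < \<infinity>"
    using g q nn_integral_lebesgue_on_representative[OF g'_eq g'(2), of "\<lambda>z. ennreal (z\<^sup>2)"]
      nn_integral_lebesgue_on_representative[OF q'_eq q'(2), of "\<lambda>z. ennreal (z\<^sup>2)"]
    by (auto simp: L2_norm_finite_iff M_def)
  then have "AE x in lborel. integrable lborel (\<lambda>y. abel_kernel \<alpha> b x y * g' y)"
    and "AE x in lborel. integrable lborel (\<lambda>y. abel_kernel \<alpha> b x y * q' y)"
    using \<open>\<alpha> < 1\<close> by (auto intro!: AE_integrable_abel_kernel)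
  then have split: "AE x in lborel. ?J g' x - ?J q' x = ?J (\<lambda>y. g' y - q' y) x"
    by eventually_elim (simp add: right_diff_distrib)
  \<comment> \<open>Unlike \<open>split\<close>, this holds everywhere on the interval, so
    measurability of \<open>?D\<close> can be read off from it.\<close>
  have D: "?D x = 1 / Gamma (1 - \<alpha>) * (?J g' x - ?J q' x)" if "x \<in> {0<..<b}" for x
    unfolding frac_kernel_integral_representative[OF g'_eq g'(1) that]
      frac_kernel_integral_representative[OF q'_eq q'(1) that]
    by (simp add: right_diff_distrib)
  show ?thesis
  proof
    show "(\<lambda>x. g' x - q' x) \<in> borel_measurable borel" by measurable
    show "g' x - q' x = 0" if "x \<notin> {0<..<b}" for x
      using g'(2) q'(2) that by simp
    show "AE x in lebesgue. x \<in> {0<..<b} \<longrightarrow> g x - q x = g' x - q' x"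
      using g'_eq q'_eq by eventually_elim auto
    have "(\<lambda>x. 1 / Gamma (1 - \<alpha>) * (?J g' x - ?J q' x)) \<in> borel_measurable lborel"
      by measurable
    then have "(\<lambda>x. 1 / Gamma (1 - \<alpha>) * (?J g' x - ?J q' x)) \<in> borel_measurable M"
      unfolding M_def by (intro measurable_restrict_space1 measurable_completion)
    then show "?D \<in> borel_measurable M"
      by (rule measurable_cong[THEN iffD1, rotated]) (use D in \<open>auto simp: M_def\<close>)
    \<comment> \<open>If the integrand is not integrable, the Bochner integral is 0 by convention
      and the bound is trivial.\<close>
    have bound: "ennreal \<bar>?J u x\<bar> \<le> (\<integral>\<^sup>+y. ennreal (abel_kernel \<alpha> b x y * \<bar>u y\<bar>) \<partial>lborel)"
      for u :: "real \<Rightarrow> real" and x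
      using integral_norm_bound_ennreal[of lborel "\<lambda>y. abel_kernel \<alpha> b x y * u y"]
      by (cases "integrable lborel (\<lambda>y. abel_kernel \<alpha> b x y * u y)")
        (auto simp: abs_mult abel_kernel_nonneg not_integrable_integral_eq)
    have "AE x in lebesgue. x \<in> {0<..<b} \<longrightarrow> \<bar>?D x\<bar>
        \<le> 1 / Gamma (1 - \<alpha>) * (\<integral>\<^sup>+y. ennreal (abel_kernel \<alpha> b x y * \<bar>g' y - q' y\<bar>) \<partial>lborel)"
      using AE_completion[OF split]
    proof eventually_elim
      case (elim x)
      show ?case
      proof
        assume "x \<in> {0<..<b}"
        then have "ennreal \<bar>?D x\<bar> = ennreal (1 / Gamma (1 - \<alpha>)) * ennreal \<bar>?J (\<lambda>y. g' y - q' y) x\<bar>"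
          using Gamma_pos by (simp only: D elim) (simp add: abs_mult ennreal_mult[symmetric])
        also have "\<dots> \<le> ennreal (1 / Gamma (1 - \<alpha>)) *
            (\<integral>\<^sup>+y. ennreal (abel_kernel \<alpha> b x y * \<bar>g' y - q' y\<bar>) \<partial>lborel)"
          by (intro mult_left_mono bound) auto
        finally show "ennreal \<bar>?D x\<bar> \<le> \<dots>" .
      qed
    qed
    then show "AE x in M. \<bar>?D x\<bar>
        \<le> 1 / Gamma (1 - \<alpha>) * (\<integral>\<^sup>+y. ennreal (abel_kernel \<alpha> b x y * \<bar>g' y - q' y\<bar>) \<partial>lborel)"
      unfolding M_def by (subst AE_restrict_space_iff) auto
  qed
qed

text \<open>This is the functional equation
  \<open>Gamma (2 - \<alpha>) = (1 - \<alpha>) * Gamma (1 - \<alpha>)\<close>.\<close>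

lemma abel_constant_div_Gamma:
  fixes \<alpha> b :: real
  assumes "\<alpha> < 1"
  shows "1 / Gamma (1 - \<alpha>) * (b powr (1 - \<alpha>) / (1 - \<alpha>)) = b powr (1 - \<alpha>) / Gamma (2 - \<alpha>)"
proof -
  have "1 - \<alpha> \<notin> \<int>\<^sub>\<le>\<^sub>0"
    using assms by (auto elim!: nonpos_Ints_cases)
  then show ?thesis
    using Gamma_plus1[of "1 - \<alpha>"] by (simp add: mult.commute)
qed

lemma L2_norm_frac_kernel_integral_diff_le:
  fixes b \<alpha> :: real and g q :: "real \<Rightarrow> real"
  defines "M \<equiv> lebesgue_on {0<..<b}"
  assumes "\<alpha> < 1" and q: "L2_norm M q < \<infinity>" and gq: "L2_norm M (\<lambda>x. g x - q x) < \<infinity>"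
  shows "L2_norm M (\<lambda>x. frac_kernel_integral \<alpha> g x - frac_kernel_integral \<alpha> q x)
           \<le> ennreal (b powr (1 - \<alpha>) / Gamma (2 - \<alpha>)) * L2_norm M (\<lambda>x. g x - q x)"
proof -
  let ?D = "\<lambda>x. frac_kernel_integral \<alpha> g x - frac_kernel_integral \<alpha> q x"
  let ?G = "1 / Gamma (1 - \<alpha>)" and ?C = "b powr (1 - \<alpha>) / (1 - \<alpha>)"
  have Gamma_pos: "Gamma (1 - \<alpha>) > 0" "Gamma (2 - \<alpha>) > 0"
    using \<open>\<alpha> < 1\<close> by (auto intro!: Gamma_real_pos)
  obtain h where h[measurable]: "h \<in> borel_measurable borel" "\<And>x. x \<notin> {0<..<b} \<Longrightarrow> h x = 0"
    and h_eq: "AE x in lebesgue. x \<in> {0<..<b} \<longrightarrow> g x - q x = h x"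
    and D: "?D \<in> borel_measurable M"
    and D_le: "AE x in M. \<bar>?D x\<bar>
           \<le> ?G * (\<integral>\<^sup>+y. ennreal (abel_kernel \<alpha> b x y * \<bar>h y\<bar>) \<partial>lborel)"
    using frac_kernel_integral_diff_representative[OF \<open>\<alpha> < 1\<close>, of b g q]
      L2_norm_finite_diff_imp[OF gq q] q unfolding M_def by blast
  let ?I = "\<lambda>x. \<integral>\<^sup>+y. ennreal (abel_kernel \<alpha> b x y * \<bar>h y\<bar>) \<partial>lborel"
  have "(\<integral>\<^sup>+x. ennreal ((?D x)\<^sup>2) \<partial>M) \<le> (\<integral>\<^sup>+x. ennreal (?G\<^sup>2) * (?I x)\<^sup>2 \<partial>M)"
  proof (intro nn_integral_mono_AE, use D_le in eventually_elim)
    case (elim x)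
    have "ennreal ((?D x)\<^sup>2) = (ennreal \<bar>?D x\<bar>)\<^sup>2"
      by (simp add: ennreal_power)
    also have "\<dots> \<le> (?G * ?I x)\<^sup>2"
      using elim by (rule power_mono) auto
    finally show ?case
      using Gamma_pos by (simp add: power_mult_distrib ennreal_power)
  qed
  also have "\<dots> = (\<integral>\<^sup>+x. ennreal (?G\<^sup>2) * (?I x)\<^sup>2 * indicator {0<..<b} x \<partial>lebesgue)"
    unfolding M_def by (intro nn_integral_restrict_space) auto
  \<comment> \<open>The domain is enlarged to the whole line, where the Schur bound is
    stated.\<close>
  also have "\<dots> \<le> (\<integral>\<^sup>+x. ennreal (?G\<^sup>2) * (?I x)\<^sup>2 \<partial>lebesgue)"
    by (intro nn_integral_mono) (auto simp: indicator_def)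
  also have "\<dots> = ennreal (?G\<^sup>2) * (\<integral>\<^sup>+x. (?I x)\<^sup>2 \<partial>lborel)"
    unfolding nn_integral_completion by (intro nn_integral_cmult) measurable
  also have "\<dots> \<le> ennreal (?G\<^sup>2) * (ennreal (?C\<^sup>2) * (\<integral>\<^sup>+y. ennreal ((h y)\<^sup>2) \<partial>lborel))"
    using \<open>\<alpha> < 1\<close> by (intro mult_left_mono abel_kernel_L2_bound) auto
  \<comment> \<open>Because \<open>h\<close> vanishes off the interval, its square integral over the
    line is that of \<open>g - q\<close> over \<open>{0<..<b}\<close>.\<close>
  also have "\<dots> = ennreal ((?G * ?C)\<^sup>2) * (\<integral>\<^sup>+x. ennreal ((g x - q x)\<^sup>2) \<partial>M)"
    using nn_integral_lebesgue_on_representative[OF h_eq h(2), of "\<lambda>z. ennreal (z\<^sup>2)"]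
    by (simp add: M_def ennreal_mult[symmetric] power_mult_distrib[symmetric] flip: mult.assoc)
  finally have le: "(\<integral>\<^sup>+x. ennreal ((?D x)\<^sup>2) \<partial>M)
      \<le> ennreal ((b powr (1 - \<alpha>) / Gamma (2 - \<alpha>))\<^sup>2) * (\<integral>\<^sup>+x. ennreal ((g x - q x)\<^sup>2) \<partial>M)"
    unfolding abel_constant_div_Gamma[OF \<open>\<alpha> < 1\<close>] .
  have "b powr (1 - \<alpha>) / Gamma (2 - \<alpha>) \<ge> 0"
    using Gamma_pos by simp
  from L2_norm_le[OF D gq this le] show ?thesis .
qed

lemma Linf_norm_frac_kernel_integral_diff_le:
  fixes b \<alpha> :: real and g q :: "real \<Rightarrow> real"
  defines "M \<equiv> lebesgue_on {0<..<b}"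
  assumes "\<alpha> < 1" and q: "L2_norm M q < \<infinity>" and gq: "Linf_norm M (\<lambda>x. g x - q x) < \<infinity>"
  shows "Linf_norm M (\<lambda>x. frac_kernel_integral \<alpha> g x - frac_kernel_integral \<alpha> q x)
           \<le> ennreal (b powr (1 - \<alpha>) / Gamma (2 - \<alpha>)) * Linf_norm M (\<lambda>x. g x - q x)"
proof -
  let ?D = "\<lambda>x. frac_kernel_integral \<alpha> g x - frac_kernel_integral \<alpha> q x"
  let ?G = "1 / Gamma (1 - \<alpha>)" and ?C = "b powr (1 - \<alpha>) / (1 - \<alpha>)"
  define E where "E = enn2real (Linf_norm M (\<lambda>x. g x - q x))"
  have E: "ennreal E = Linf_norm M (\<lambda>x. g x - q x)" "E \<ge> 0"
    using gq by (auto simp: E_def)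
  have Gamma_pos: "Gamma (1 - \<alpha>) > 0"
    using \<open>\<alpha> < 1\<close> by (intro Gamma_real_pos) auto
  \<comment> \<open>On a bounded interval a finite supremum norm of \<open>g - q\<close> gives a
    finite square norm, hence one for \<open>g\<close>.\<close>
  have "finite_measure M"
    unfolding M_def by (intro finite_measure_lebesgue_on) auto
  then have "L2_norm M g < \<infinity>"
    using L2_norm_finite_diff_imp[OF L2_norm_finite_if_Linf_norm_finite[OF _ gq] q] by simp
  then obtain h where h[measurable]: "h \<in> borel_measurable borel" "\<And>x. x \<notin> {0<..<b} \<Longrightarrow> h x = 0"
    and h_eq: "AE x in lebesgue. x \<in> {0<..<b} \<longrightarrow> g x - q x = h x"
    and D[measurable]: "?D \<in> borel_measurable M"
    and D_le: "AE x in M. \<bar>?D x\<bar>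
           \<le> ?G * (\<integral>\<^sup>+y. ennreal (abel_kernel \<alpha> b x y * \<bar>h y\<bar>) \<partial>lborel)"
    using frac_kernel_integral_diff_representative[OF \<open>\<alpha> < 1\<close>, of b g q] q
    unfolding M_def by blast
  have "AE x in lebesgue. x \<in> {0<..<b} \<longrightarrow> \<bar>g x - q x\<bar> \<le> E"
    using AE_abs_le_Linf_norm(2)[OF gq] unfolding E_def M_def
    by (subst (asm) AE_restrict_space_iff) auto
  \<comment> \<open>Off the interval \<open>h\<close> is 0 and \<open>E \<ge> 0\<close>, so the
    bound extends to the whole line.\<close>
  with h_eq have "AE y in lebesgue. \<bar>h y\<bar> \<le> E"
  proof eventually_elim
    case (elim y)
    then show ?case using h(2)[of y] \<open>E \<ge> 0\<close> by (cases "y \<in> {0<..<b}") auto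
  qed
  then have h_le: "AE y in lborel. \<bar>h y\<bar> \<le> E"
    by (simp add: AE_completion_iff)
  \<comment> \<open>The supremum estimate takes only the row bound of the kernel, with
    \<open>E\<close> pulled out of the integral.\<close>
  have I_le: "(\<integral>\<^sup>+y. ennreal (abel_kernel \<alpha> b x y * \<bar>h y\<bar>) \<partial>lborel) \<le> ennreal ?C * ennreal E" for x
  proof -
    have "(\<integral>\<^sup>+y. ennreal (abel_kernel \<alpha> b x y * \<bar>h y\<bar>) \<partial>lborel)
        \<le> (\<integral>\<^sup>+y. ennreal (abel_kernel \<alpha> b x y) * ennreal E \<partial>lborel)"
      using h_le by (intro nn_integral_mono_AE, eventually_elim)
        (auto simp: ennreal_mult[symmetric] abel_kernel_nonneg \<open>E \<ge> 0\<close> intro!: ennreal_leI mult_left_mono)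
    also have "\<dots> = (\<integral>\<^sup>+y. ennreal (abel_kernel \<alpha> b x y) \<partial>lborel) * ennreal E"
      by (intro nn_integral_multc) measurable
    also have "\<dots> \<le> ennreal ?C * ennreal E"
      by (intro mult_right_mono nn_integral_abel_kernel_right \<open>\<alpha> < 1\<close>) auto
    finally show ?thesis .
  qed
  have "AE x in M. ennreal \<bar>?D x\<bar> \<le> ennreal (?G * ?C) * ennreal E"
    using D_le
  proof eventually_elim
    case (elim x)
    also have "?G * (\<integral>\<^sup>+y. ennreal (abel_kernel \<alpha> b x y * \<bar>h y\<bar>) \<partial>lborel)
        \<le> ?G * (ennreal ?C * ennreal E)"
      by (intro mult_left_mono I_le) auto
    also have "\<dots> = ennreal (?G * ?C) * ennreal E"
      using Gamma_pos \<open>\<alpha> < 1\<close> by (subst ennreal_mult) (auto simp: mult.assoc)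
    finally show ?case .
  qed
  then have "esssup M (\<lambda>x. ennreal \<bar>?D x\<bar>) \<le> ennreal (?G * ?C) * ennreal E"
    by (intro esssup_I) measurable
  moreover have "Linf_norm M ?D = esssup M (\<lambda>x. ennreal \<bar>?D x\<bar>)"
    using D by (simp only: Linf_norm_def if_True)
  ultimately show ?thesis
    by (simp only: abel_constant_div_Gamma[OF \<open>\<alpha> < 1\<close>] E(1))
qed

theorem theorem2:
  fixes \<alpha> b T \<eta> :: real and f :: "real \<Rightarrow> real" and N m K :: nat
    and r a :: "nat \<Rightarrow> real" and U S V :: "real mat" and q :: "real \<Rightarrow> real"
  assumes "0 < \<alpha>" and "\<alpha> < 1" and "b > 0"
    and "abs_continuous_on 0 b f"
    and "T > 1" and "N \<ge> 1" and "m \<ge> 2" and "\<eta> > 0"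
    and "\<And>j. j < N \<Longrightarrow> r j > 0"
    and "is_svd (frame_mat T m N * inv_weight_mat N r) U S V"
    and "a 0 = 0" and "a K = b" and "\<And>k. k < K \<Longrightarrow> a k < a (Suc k)"
    and "q = piecewise_frame_deriv T m N r \<eta> U S V K a f"
    and "L2_norm (lebesgue_on {0<..<b}) q < \<infinity>"
  shows "L2_norm (lebesgue_on {0<..<b}) (\<lambda>x. caputo_deriv \<alpha> f x - frac_kernel_integral \<alpha> q x)
           \<le> ennreal (b powr (1 - \<alpha>) / Gamma (2 - \<alpha>)) *
               L2_norm (lebesgue_on {0<..<b}) (\<lambda>x. deriv f x - q x)
       \<and> (Linf_norm (lebesgue_on {0<..<b}) (\<lambda>x. deriv f x - q x) < \<infinity> \<longrightarrow>
          Linf_norm (lebesgue_on {0<..<b}) (\<lambda>x. caputo_deriv \<alpha> f x - frac_kernel_integral \<alpha> q x)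
           \<le> ennreal (b powr (1 - \<alpha>) / Gamma (2 - \<alpha>)) *
               Linf_norm (lebesgue_on {0<..<b}) (\<lambda>x. deriv f x - q x))"
proof (intro conjI impI)
  show "L2_norm (lebesgue_on {0<..<b}) (\<lambda>x. caputo_deriv \<alpha> f x - frac_kernel_integral \<alpha> q x)
      \<le> ennreal (b powr (1 - \<alpha>) / Gamma (2 - \<alpha>)) *
          L2_norm (lebesgue_on {0<..<b}) (\<lambda>x. deriv f x - q x)"
  proof (cases "L2_norm (lebesgue_on {0<..<b}) (\<lambda>x. deriv f x - q x) < \<infinity>")
    case True
    then show ?thesis
      unfolding caputo_deriv_def
      by (rule L2_norm_frac_kernel_integral_diff_le[OF \<open>\<alpha> < 1\<close> assms(15)])
  next
    case False
    \<comment> \<open>Strict positivity matters: \<open>0 * \<infinity>\<close> is 0 in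
      \<open>ennreal\<close>, and only a nonzero factor keeps the right-hand side infinite.\<close>
    moreover have "b powr (1 - \<alpha>) / Gamma (2 - \<alpha>) > 0"
      using \<open>\<alpha> < 1\<close> \<open>b > 0\<close> by (intro divide_pos_pos Gamma_real_pos) auto
    ultimately show ?thesis
      by (auto simp: not_less top_unique ennreal_mult_top)
  qed
next
  assume "Linf_norm (lebesgue_on {0<..<b}) (\<lambda>x. deriv f x - q x) < \<infinity>"
  then show "Linf_norm (lebesgue_on {0<..<b})
        (\<lambda>x. caputo_deriv \<alpha> f x - frac_kernel_integral \<alpha> q x)
      \<le> ennreal (b powr (1 - \<alpha>) / Gamma (2 - \<alpha>)) *
          Linf_norm (lebesgue_on {0<..<b}) (\<lambda>x. deriv f x - q x)"
    unfolding caputo_deriv_def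
    by (rule Linf_norm_frac_kernel_integral_diff_le[OF \<open>\<alpha> < 1\<close> assms(15)])
qed

end
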